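(* Let $r\geq 1$ and $k\geq 3$ be integers and let $t$ be a non-negative integer. If $J(C_k,r)\cup tP_3$ is antimagic, then $$t\leq\min\left\{(1+\sqrt{2})\left(kr+k+\tfrac{1}{2}\right),\ 2kr+7k+1\right\}.$$ Consequently, if $r\geq 11$, then $\tau(J(C_3,r))\leq 6r+22$.
   Context: Graphs are finite and simple, not necessarily connected. For a graph $G$ with $m$ edges and a bijection $f: E(G)\to\{1,2,\dots,m\}$, let $\phi_f(v)$ be the sum of $f(e)$ over all edges $e$ incident to the vertex $v$. The bijection $f$ is an antimagic labeling of $G$ if $\phi_f(u)\neq\phi_f(v)$ for all pairs of distinct vertices $u,v$; $G$ is antimagic if it admits an antimagic labeling. $P_j$ is the path on $j$ vertices, $C_j$ the cycle on $j$ vertices. $G\cup H$ denotes disjoint union, and $tG$ the disjoint union of $t$ copies of $G$. For positive integers $r$ and $k$ with $k\geq 3$, the jellyfish graph $J(C_k,r)$ is obtained from the cycle $C_k$ by attaching $r$ pendant edges (each with a new leaf) to each vertex of $C_k$. If $G$ is antimagic, $\tau(G)$ is the maximum non-negative integer $t$ such that $G\cup t'P_3$ is antimagic for all integers $0\leq t'\leq t$; if $G$ is not antimagic, $\tau(G)=-\infty$. *)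

theory Defs
  imports Complex_Main "HOL-Library.Extended_Real"
begin

record 'a graph =
  verts :: "'a set"
  edges :: "'a set set"

definition simple_graph :: "'a graph \<Rightarrow> bool" where
  "simple_graph G \<longleftrightarrow> finite (verts G) \<and> (\<forall>e\<in>edges G. e \<subseteq> verts G \<and> card e = 2)"

definition vertex_sum :: "'a graph \<Rightarrow> ('a set \<Rightarrow> nat) \<Rightarrow> 'a \<Rightarrow> nat" where
  "vertex_sum G f v = (\<Sum>e\<in>{e \<in> edges G. v \<in> e}. f e)"

definition antimagic_labeling :: "'a graph \<Rightarrow> ('a set \<Rightarrow> nat) \<Rightarrow> bool" where
  "antimagic_labeling G f \<longleftrightarrow>
     bij_betw f (edges G) {1..card (edges G)} \<and>
     (\<forall>u\<in>verts G. \<forall>v\<in>verts G. u \<noteq> v \<longrightarrow> vertex_sum G f u \<noteq> vertex_sum G f v)"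

definition antimagic :: "'a graph \<Rightarrow> bool" where
  "antimagic G \<longleftrightarrow> (\<exists>f. antimagic_labeling G f)"

definition path_graph :: "nat \<Rightarrow> nat graph" where
  "path_graph j = \<lparr>verts = {..<j}, edges = {{i, Suc i} |i. Suc i < j}\<rparr>"

text \<open>A cycle only for \<open>j \<ge> 3\<close>.\<close>
definition cycle_graph :: "nat \<Rightarrow> nat graph" where
  "cycle_graph j = \<lparr>verts = {..<j}, edges = {{i, Suc i mod j} |i. i < j}\<rparr>"

definition disjoint_union :: "'a graph \<Rightarrow> 'b graph \<Rightarrow> ('a + 'b) graph" where
  "disjoint_union G H =
     \<lparr>verts = verts G <+> verts H,
      edges = (image Inl) ` edges G \<union> (image Inr) ` edges H\<rparr>"

definition copies :: "nat \<Rightarrow> 'a graph \<Rightarrow> (nat \<times> 'a) graph" where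
  "copies t G =
     \<lparr>verts = {..<t} \<times> verts G,
      edges = {Pair i ` e |i e. i < t \<and> e \<in> edges G}\<rparr>"

text \<open>The leaves attached to \<open>Inl v\<close> are \<open>Inr (v, i)\<close> for \<open>i < r\<close>.\<close>
definition attach_pendants :: "'a graph \<Rightarrow> nat \<Rightarrow> ('a + 'a \<times> nat) graph" where
  "attach_pendants G r =
     \<lparr>verts = verts G <+> verts G \<times> {..<r},
      edges = (image Inl) ` edges G \<union>
              {{Inl v, Inr (v, i)} |v i. v \<in> verts G \<and> i < r}\<rparr>"

definition jellyfish :: "nat \<Rightarrow> nat \<Rightarrow> (nat + nat \<times> nat) graph" where
  "jellyfish k r = attach_pendants (cycle_graph k) r"

text \<open>
  For an antimagic graph the set below contains 0 and is downward closed, so its supremum is its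
  maximum if it is bounded; if it is unbounded (no maximum exists) the value is \<open>\<infinity>\<close>.
\<close>
definition tau :: "'a graph \<Rightarrow> ereal" where
  "tau G =
     (if antimagic G
      then (SUP t\<in>{t. \<forall>t'\<le>t. antimagic (disjoint_union G (copies t' (path_graph 3)))}. ereal (real t))
      else - \<infinity>)"

lemma simple_graph_path: "simple_graph (path_graph j)"
  by (auto simp: simple_graph_def path_graph_def)

lemma simple_graph_cycle:
  assumes "j \<ge> 3"
  shows "simple_graph (cycle_graph j)"
  using assms by (auto simp: simple_graph_def cycle_graph_def mod_Suc)

lemma simple_graph_disjoint_union:
  assumes "simple_graph G" "simple_graph H"
  shows "simple_graph (disjoint_union G H)"
  using assms by (auto simp: simple_graph_def disjoint_union_def card_image)

lemma simple_graph_copies: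
  assumes "simple_graph G"
  shows "simple_graph (copies t G)"
  using assms by (auto simp: simple_graph_def copies_def card_image inj_on_def)

lemma simple_graph_attach_pendants:
  assumes "simple_graph G"
  shows "simple_graph (attach_pendants G r)"
  using assms by (auto simp: simple_graph_def attach_pendants_def card_image)

lemma simple_graph_jellyfish:
  assumes "k \<ge> 3"
  shows "simple_graph (jellyfish k r)"
  unfolding jellyfish_def by (intro simple_graph_attach_pendants simple_graph_cycle assms)

end

theory Submission
  imports Defs
begin

text \<open>
  Write \<open>H\<close> for the union of a graph \<open>G\<close> with \<open>t\<close> copies of the path on three vertices, let \<open>m\<close> be
  the number of edges of \<open>G\<close>, and let \<open>M = m + 2t\<close> be the number of edges of \<open>H\<close>. Both bounds on
  \<open>t\<close> come from comparing a sum of distinct vertex sums with a sum of labels.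

  The bound with \<open>\<surd>2\<close> counts all vertices. Every label is counted at two vertices, so the vertex
  sums add up to \<open>M(M + 1)\<close>. If no vertex is isolated they are distinct positive integers, so \<open>n\<close>
  vertices give at least \<open>n(n + 1)/2\<close> (lemma \<open>antimagic_card_verts_bound\<close>). The jellyfish has as
  many vertices as edges, so here \<open>n = M + t\<close>, and the quadratic inequality in \<open>t\<close> that results has
  \<open>(1 + \<surd>2)(m + 1/2)\<close> as an upper bound for its solutions (lemma \<open>sqrt2_bound\<close>).

  The linear bound looks only at the midpoints of the added paths. A midpoint whose sum is at most
  \<open>M\<close> has the label of some edge as its sum. That edge cannot have an end of degree one, because
  this end would have the same sum; so it is one of the \<open>q\<close> edges of \<open>G\<close> without such an end, and at
  most \<open>q\<close> midpoints are of this kind. The other \<open>s \<ge> t - q\<close> midpoints have distinct sums above \<open>M\<close>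
  that are made up of \<open>2s\<close> distinct labels, none above \<open>M\<close>. Hence
  \<open>sM + s(s + 1)/2 \<le> s(2M - 2s + 1)\<close>, that is, \<open>5s \<le> 2M + 1\<close>, which rearranges to
  \<open>t \<le> 2m + 5q + 1\<close> (lemma \<open>antimagic_union_paths_bound\<close>). In a jellyfish only the cycle edges
  lack an end of degree one, so \<open>q \<le> k\<close>.
\<close>

section \<open>Sums of distinct natural numbers\<close>

lemma sum_distinct_ge:
  fixes A :: "nat set"
  assumes "finite A" "\<forall>x\<in>A. c < x"
  shows "2 * card A * c + card A * (card A + 1) \<le> 2 * \<Sum>A"
  using assms
proof (induction A rule: finite_linorder_max_induct)
  case (insert b A)
  have "A \<subseteq> {c<..<b}" using insert by auto
  then have "card A \<le> card {c<..<b}" by (intro card_mono) auto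
  then have "c + card A + 1 \<le> b" using insert.prems by auto
  moreover have "b \<notin> A" using insert by auto
  ultimately show ?case using insert by (simp add: algebra_simps)
qed simp

lemma sum_distinct_le:
  fixes A :: "nat set"
  assumes "finite A" "\<forall>x\<in>A. x \<le> M"
  shows "2 * \<Sum>A + card A * card A \<le> card A * (2 * M + 1)"
  using assms
proof (induction A rule: finite_linorder_min_induct)
  case (insert b A)
  have "A \<subseteq> {b<..M}" using insert by auto
  then have "card A \<le> card {b<..M}" by (intro card_mono) auto
  then have "b + card A \<le> M" using insert.prems by auto
  moreover have "b \<notin> A" using insert by auto
  ultimately show ?case using insert by (simp add: algebra_simps)
qed simp

section \<open>Vertex sums\<close>

lemma finite_edges: "simple_graph G \<Longrightarrow> finite (edges G)"
  unfolding simple_graph_def by (rule finite_subset[of _ "Pow (verts G)"]) auto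

lemma vertex_sum_disjoint_union_Inl:
  "vertex_sum (disjoint_union G H) f (Inl v) = vertex_sum G (\<lambda>e. f (Inl ` e)) v"
proof -
  have "{e \<in> edges (disjoint_union G H). Inl v \<in> e} = image Inl ` {e \<in> edges G. v \<in> e}"
    by (auto simp: disjoint_union_def)
  then show ?thesis
    unfolding vertex_sum_def
    by (simp add: sum.reindex inj_on_def inj_image_eq_iff)
qed

lemma vertex_sum_disjoint_union_Inr:
  "vertex_sum (disjoint_union G H) f (Inr v) = vertex_sum H (\<lambda>e. f (Inr ` e)) v"
proof -
  have "{e \<in> edges (disjoint_union G H). Inr v \<in> e} = image Inr ` {e \<in> edges H. v \<in> e}"
    by (auto simp: disjoint_union_def)
  then show ?thesis
    unfolding vertex_sum_def
    by (simp add: sum.reindex inj_on_def inj_image_eq_iff)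
qed

lemma vertex_sum_copies:
  assumes "i < t"
  shows "vertex_sum (copies t G) f (i, v) = vertex_sum G (\<lambda>e. f (Pair i ` e)) v"
proof -
  have "{e \<in> edges (copies t G). (i, v) \<in> e} = image (Pair i) ` {e \<in> edges G. v \<in> e}"
    using assms by (auto simp: copies_def)
  moreover have "inj (Pair i :: 'a \<Rightarrow> nat \<times> 'a)" by (simp add: inj_on_def)
  ultimately show ?thesis
    unfolding vertex_sum_def
    by (simp add: sum.reindex inj_on_def inj_image_eq_iff)
qed

lemma edges_path_graph_3: "edges (path_graph 3) = {{0, 1}, {1, 2}}"
proof -
  have "edges (path_graph 3) = (\<lambda>i. {i, Suc i}) ` {i. Suc i < 3}"
    by (auto simp: path_graph_def)
  also have "{i. Suc i < 3} = {0, 1}" by auto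
  finally show ?thesis by (simp add: numeral_2_eq_2)
qed

lemma vertex_sum_path_graph_3:
  "vertex_sum (path_graph 3) f 0 = f {0, 1}"
  "vertex_sum (path_graph 3) f 1 = f {0, 1} + f {1, 2}"
  "vertex_sum (path_graph 3) f 2 = f {1, 2}"
proof -
  have "{e \<in> {{0, 1}, {1, 2::nat}}. 0 \<in> e} = {{0, 1}}"
    "{e \<in> {{0, 1}, {1, 2::nat}}. 1 \<in> e} = {{0, 1}, {1, 2}}"
    "{e \<in> {{0, 1}, {1, 2::nat}}. 2 \<in> e} = {{1, 2}}" by auto
  moreover have "{0, 1} \<noteq> {1, 2::nat}" by (auto simp: doubleton_eq_iff)
  ultimately show "vertex_sum (path_graph 3) f 0 = f {0, 1}"
    "vertex_sum (path_graph 3) f 1 = f {0, 1} + f {1, 2}"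
    "vertex_sum (path_graph 3) f 2 = f {1, 2}"
    unfolding vertex_sum_def edges_path_graph_3 by simp_all
qed

lemma vertex_sum_degree_one:
  assumes "e \<in> edges G" "v \<in> e" "\<forall>e'\<in>edges G. v \<in> e' \<longrightarrow> e' = e"
  shows "vertex_sum G f v = f e"
proof -
  have "{e \<in> edges G. v \<in> e} = {e}" using assms by blast
  then show ?thesis by (simp add: vertex_sum_def)
qed

text \<open>Each label is counted once at each of the two ends of its edge.\<close>
lemma sum_vertex_sums:
  assumes "simple_graph G"
  shows "(\<Sum>v\<in>verts G. vertex_sum G f v) = 2 * (\<Sum>e\<in>edges G. f e)"
proof -
  have fin: "finite (verts G)" "finite (edges G)"
    using assms finite_edges by (auto simp: simple_graph_def)
  have "(\<Sum>v\<in>verts G. vertex_sum G f v) = (\<Sum>e\<in>edges G. \<Sum>v\<in>{v \<in> verts G. v \<in> e}. f e)"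
    unfolding vertex_sum_def using fin by (rule sum.swap_restrict)
  also have "\<dots> = (\<Sum>e\<in>edges G. 2 * f e)"
  proof (rule sum.cong)
    fix e assume "e \<in> edges G"
    then have "{v \<in> verts G. v \<in> e} = e" "card e = 2" using assms by (auto simp: simple_graph_def)
    then show "(\<Sum>v\<in>{v \<in> verts G. v \<in> e}. f e) = 2 * f e" by simp
  qed simp
  finally show ?thesis by (simp add: sum_distrib_left)
qed

section \<open>Bounds from antimagic labelings\<close>

lemma antimagic_card_verts_bound:
  assumes G: "simple_graph G" and anti: "antimagic G"
    and no_isolated: "\<forall>v\<in>verts G. \<exists>e\<in>edges G. v \<in> e"
  shows "card (verts G) * (card (verts G) + 1) \<le> 2 * (card (edges G) * (card (edges G) + 1))"
proof -
  let ?n = "card (verts G)" and ?M = "card (edges G)"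
  obtain f where bij: "bij_betw f (edges G) {1..?M}"
    and inj: "inj_on (vertex_sum G f) (verts G)"
    using anti unfolding antimagic_def antimagic_labeling_def inj_on_def by blast
  have fin: "finite (edges G)" "finite (verts G)"
    using G finite_edges by (auto simp: simple_graph_def)
  have pos: "0 < vertex_sum G f v" if v: "v \<in> verts G" for v
  proof -
    obtain e where e: "e \<in> edges G" "v \<in> e" using no_isolated v by auto
    have "0 < f e" using bij_betwE[OF bij] e by force
    also have "f e \<le> vertex_sum G f v"
      unfolding vertex_sum_def using fin e by (intro member_le_sum) auto
    finally show ?thesis .
  qed
  have "?n * (?n + 1) \<le> 2 * \<Sum>(vertex_sum G f ` verts G)"
    using sum_distinct_ge[of "vertex_sum G f ` verts G" 0] fin pos
    by (simp add: card_image[OF inj])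
  also have "\<Sum>(vertex_sum G f ` verts G) = 2 * (\<Sum>e\<in>edges G. f e)"
    using sum_vertex_sums[OF G] by (simp add: sum.reindex[OF inj])
  also have "(\<Sum>e\<in>edges G. f e) = \<Sum>{1..?M}"
    using sum.reindex_bij_betw[OF bij, of "\<lambda>x. x"] by simp
  also have "2 * \<Sum>{1..?M} = ?M * (?M + 1)"
    using double_gauss_sum_from_Suc_0[of ?M, where ?'a = nat]
    by (simp only: of_nat_id One_nat_def)
  finally show ?thesis .
qed

text \<open>
  The two labels of a path in a set \<open>I\<close> of paths are \<open>a i\<close> and \<open>b i\<close>. Large distinct sums need
  large labels, but there are not enough labels close to \<open>M\<close> for many such sums.
\<close>
lemma disjoint_pairs_large_sums_bound:
  fixes a b :: "nat \<Rightarrow> nat"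
  assumes I: "finite I" and inj: "inj_on a I" "inj_on b I" and disj: "a ` I \<inter> b ` I = {}"
    and le: "\<forall>i\<in>I. a i \<le> M \<and> b i \<le> M"
    and inj_sum: "inj_on (\<lambda>i. a i + b i) I" and large: "\<forall>i\<in>I. M < a i + b i"
  shows "5 * card I \<le> 2 * M + 1"
proof (cases "I = {}")
  case False
  let ?s = "card I" and ?S = "\<Sum>i\<in>I. a i + b i"
  have "0 < ?s" using False I by (simp add: card_gt_0_iff)
  have "2 * ?s * M + ?s * (?s + 1) \<le> 2 * ?S"
    using sum_distinct_ge[of "(\<lambda>i. a i + b i) ` I" M] I large
    by (simp add: card_image[OF inj_sum] sum.reindex[OF inj_sum])
  moreover have "2 * ?S + (2 * ?s) * (2 * ?s) \<le> (2 * ?s) * (2 * M + 1)"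
  proof -
    have "card (a ` I \<union> b ` I) = 2 * ?s"
      using I disj inj by (simp add: card_Un_disjoint card_image)
    moreover have "\<Sum>(a ` I \<union> b ` I) = ?S"
      using I disj inj by (simp add: sum.union_disjoint sum.reindex sum.distrib)
    ultimately show ?thesis
      using sum_distinct_le[of "a ` I \<union> b ` I" M] I le by auto
  qed
  ultimately have "?s * (5 * ?s) \<le> ?s * (2 * M + 1)" by (simp add: algebra_simps)
  then show ?thesis using \<open>0 < ?s\<close> by (simp only: mult_le_cancel1)
qed simp

lemma edges_union_paths:
  "edges (disjoint_union G (copies t (path_graph 3))) =
    image Inl ` edges G \<union>
    (\<lambda>i. {Inr (i, 0), Inr (i, 1)}) ` {..<t} \<union> (\<lambda>i. {Inr (i, 1), Inr (i, 2)}) ` {..<t}"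
proof -
  have "{Pair i ` e |i e. i < t \<and> e \<in> {{0, 1}, {1, 2 :: nat}}} =
    (\<lambda>i. Pair i ` {0, 1}) ` {..<t} \<union> (\<lambda>i. Pair i ` {1, 2}) ` {..<t}"
    by blast
  then show ?thesis
    unfolding disjoint_union_def copies_def edges_path_graph_3
    by (simp add: image_Un image_image Un_assoc)
qed

lemma card_edges_union_paths_le:
  assumes "simple_graph G"
  shows "card (edges (disjoint_union G (copies t (path_graph 3)))) \<le> card (edges G) + 2 * t"
proof -
  let ?A = "image Inl ` edges G :: ('a + nat \<times> nat) set set"
  let ?B = "(\<lambda>i. {Inr (i, 0), Inr (i, 1)}) ` {..<t} :: ('a + nat \<times> nat) set set"
  let ?C = "(\<lambda>i. {Inr (i, 1), Inr (i, 2)}) ` {..<t} :: ('a + nat \<times> nat) set set"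
  have "card ?A \<le> card (edges G)" by (intro card_image_le finite_edges assms)
  moreover have "card ?B \<le> t" using card_image_le[of "{..<t}"] by fastforce
  moreover have "card ?C \<le> t" using card_image_le[of "{..<t}"] by fastforce
  moreover have "card (?A \<union> ?B \<union> ?C) \<le> card ?A + card ?B + card ?C"
    by (meson add_mono_thms_linordered_semiring(3) card_Un_le le_trans)
  ultimately show ?thesis unfolding edges_union_paths by linarith
qed

text \<open>
  The set in the conclusion consists of the edges without an end of degree one. Only their labels
  can occur as the sum of a midpoint: the label of any other edge is already the vertex sum of a
  leaf. All other midpoints have sums above the number of edges, which
  \<open>disjoint_pairs_large_sums_bound\<close> allows only for few paths.
\<close>
lemma antimagic_union_paths_bound:
  fixes G :: "'a graph"
  assumes G: "simple_graph G"
    and anti: "antimagic (disjoint_union G (copies t (path_graph 3)))"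
  shows "t \<le> 2 * card (edges G)
    + 5 * card {e \<in> edges G. \<forall>v\<in>e. \<exists>e'\<in>edges G. v \<in> e' \<and> e' \<noteq> e} + 1"
proof -
  define H where "H = disjoint_union G (copies t (path_graph 3))"
  define M where "M = card (edges H)"
  define inner where "inner = {e \<in> edges G. \<forall>v\<in>e. \<exists>e'\<in>edges G. v \<in> e' \<and> e' \<noteq> e}"
  obtain f where bij: "bij_betw f (edges H) {1..M}"
    and distinct: "\<And>u v. u \<in> verts H \<Longrightarrow> v \<in> verts H \<Longrightarrow> vertex_sum H f u = vertex_sum H f v \<Longrightarrow> u = v"
    using anti unfolding antimagic_def antimagic_labeling_def H_def M_def by blast
  have inj: "inj_on f (edges H)" using bij by (simp add: bij_betw_def)
  define p where "p i = ({Inr (i, 0), Inr (i, 1)} :: ('a + nat \<times> nat) set)" for i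
  define q where "q i = ({Inr (i, 1), Inr (i, 2)} :: ('a + nat \<times> nat) set)" for i
  have edges_H: "edges H = image Inl ` edges G \<union> p ` {..<t} \<union> q ` {..<t}"
    unfolding H_def p_def q_def by (rule edges_union_paths)
  have path_verts: "Inr (i, j) \<in> verts H" if "i < t" "j < 3" for i j
    using that by (auto simp: H_def disjoint_union_def copies_def path_graph_def)
  have path_sums: "vertex_sum H f (Inr (i, 0)) = f (p i)"
    "vertex_sum H f (Inr (i, 1)) = f (p i) + f (q i)"
    "vertex_sum H f (Inr (i, 2)) = f (q i)" if "i < t" for i
    using that unfolding H_def p_def q_def
    by (simp_all add: vertex_sum_disjoint_union_Inr vertex_sum_copies vertex_sum_path_graph_3
        del: One_nat_def)
  define small where "small = {i. i < t \<and> f (p i) + f (q i) \<le> M}"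
  define large where "large = {i. i < t \<and> M < f (p i) + f (q i)}"
  have mid_inj: "i = j" if "i < t" "j < t" "f (p i) + f (q i) = f (p j) + f (q j)" for i j
    using distinct[of "Inr (i, 1)" "Inr (j, 1)"] path_verts path_sums that by simp
  have le: "1 \<le> f e \<and> f e \<le> M" if "e \<in> edges H" for e
    using bij_betwE[OF bij] that by auto
  have small_inner: "\<exists>e\<in>inner. f (Inl ` e) = f (p i) + f (q i)" if i: "i \<in> small" for i
  proof -
    have it: "i < t" using i by (simp add: small_def)
    have "p i \<in> edges H" using it edges_H by blast
    then have "f (p i) + f (q i) \<in> f ` edges H"
      using i le[of "p i"] bij by (simp add: small_def bij_betw_def)
    then obtain e where e: "e \<in> edges H" "f e = f (p i) + f (q i)" by force
    \<comment> \<open>The label of \<open>e\<close> is taken as a vertex sum by the midpoint of path \<open>i\<close>, hence by no leaf.\<close>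
    have no_leaf: "vertex_sum H f v \<noteq> f e" if "v \<in> verts H" "v \<noteq> Inr (i, 1)" for v
      using distinct[OF that(1) path_verts[OF it, of 1]] path_sums(2)[OF it] that(2) e(2) by auto
    have "e \<noteq> p j" if "j < t" for j
      using no_leaf[OF path_verts[OF that, of 0]] path_sums(1)[OF that] by auto
    moreover have "e \<noteq> q j" if "j < t" for j
      using no_leaf[OF path_verts[OF that, of 2]] path_sums(3)[OF that] by auto
    ultimately obtain e' where e': "e' \<in> edges G" "e = Inl ` e'"
      using e(1) unfolding edges_H by blast
    have "\<exists>e''\<in>edges G. v \<in> e'' \<and> e'' \<noteq> e'" if v: "v \<in> e'" for v
    proof (rule ccontr)
      assume "\<not> ?thesis"
      then have "vertex_sum H f (Inl v) = f e"
        using vertex_sum_degree_one[OF e'(1) v, of "\<lambda>e. f (Inl ` e)"] e'(2)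
        unfolding H_def vertex_sum_disjoint_union_Inl by blast
      moreover have "Inl v \<in> verts H"
        using G e' v by (auto simp: H_def disjoint_union_def simple_graph_def)
      ultimately show False using no_leaf by blast
    qed
    then have "e' \<in> inner" using e'(1) by (simp add: inner_def)
    then show ?thesis using e(2) e'(2) by blast
  qed
  have "finite inner" unfolding inner_def using finite_edges[OF G] by simp
  have "card small \<le> card inner"
  proof -
    obtain g where g: "\<And>i. i \<in> small \<Longrightarrow> g i \<in> inner \<and> f (Inl ` g i) = f (p i) + f (q i)"
      using small_inner by metis
    have "inj_on g small"
      by (rule inj_onI) (metis (mono_tags, lifting) g mid_inj mem_Collect_eq small_def)
    moreover have "g ` small \<subseteq> inner" using g by auto
    ultimately show ?thesis using \<open>finite inner\<close> by (rule card_inj_on_le)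
  qed
  moreover have "t = card small + card large"
  proof -
    have "{..<t} = small \<union> large" "small \<inter> large = {}" by (auto simp: small_def large_def)
    moreover have "finite small" "finite large" by (auto simp: small_def large_def)
    ultimately show ?thesis by (metis card_Un_disjoint card_lessThan)
  qed
  moreover have "5 * card large \<le> 2 * M + 1"
  proof (rule disjoint_pairs_large_sums_bound[of large "\<lambda>i. f (p i)" "\<lambda>i. f (q i)"])
    have pE: "p i \<in> edges H" and qE: "q i \<in> edges H" if "i \<in> large" for i
      using that edges_H by (auto simp: large_def)
    have "p i = p j \<Longrightarrow> i = j" "q i = q j \<Longrightarrow> i = j" for i j
      by (auto simp: p_def q_def doubleton_eq_iff)
    then show "inj_on (\<lambda>i. f (p i)) large" "inj_on (\<lambda>i. f (q i)) large"
      using pE qE by (auto intro!: inj_onI dest!: inj_onD[OF inj])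
    have "p i \<noteq> q j" for i j by (auto simp: p_def q_def doubleton_eq_iff)
    then show "(\<lambda>i. f (p i)) ` large \<inter> (\<lambda>i. f (q i)) ` large = {}"
      using pE qE by (auto dest!: inj_onD[OF inj])
    show "\<forall>i\<in>large. f (p i) \<le> M \<and> f (q i) \<le> M" using le pE qE by blast
    show "inj_on (\<lambda>i. f (p i) + f (q i)) large"
      using mid_inj by (auto simp: inj_on_def large_def)
  qed (auto simp: large_def)
  moreover have "M \<le> card (edges G) + 2 * t"
    unfolding M_def H_def by (rule card_edges_union_paths_le[OF G])
  ultimately show ?thesis unfolding inner_def[symmetric] by linarith
qed

section \<open>Jellyfish graphs\<close>

lemma card_cycle_edges_le: "card (edges (cycle_graph k)) \<le> k"
proof -
  have "edges (cycle_graph k) = (\<lambda>i. {i, Suc i mod k}) ` {..<k}"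
    by (auto simp: cycle_graph_def)
  then show ?thesis using card_image_le[of "{..<k}"] by fastforce
qed

lemma finite_cycle_edges: "finite (edges (cycle_graph k))"
proof -
  have "edges (cycle_graph k) = (\<lambda>i. {i, Suc i mod k}) ` {..<k}"
    by (auto simp: cycle_graph_def)
  then show ?thesis by simp
qed

lemma card_verts_jellyfish: "card (verts (jellyfish k r)) = k * r + k"
  by (simp add: jellyfish_def attach_pendants_def cycle_graph_def card_Plus)

lemma edges_jellyfish:
  "edges (jellyfish k r) = image Inl ` edges (cycle_graph k) \<union>
    (\<lambda>(v, i). {Inl v, Inr (v, i)}) ` ({..<k} \<times> {..<r})"
proof -
  have "{g v i |v i. v \<in> {..<k} \<and> i < r} = (\<lambda>(v, i). g v i) ` ({..<k} \<times> {..<r})"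
    for g :: "nat \<Rightarrow> nat \<Rightarrow> (nat + nat \<times> nat) set"
    by force
  then show ?thesis by (simp add: jellyfish_def attach_pendants_def cycle_graph_def)
qed

lemma card_edges_jellyfish_le: "card (edges (jellyfish k r)) \<le> k * r + k"
proof -
  let ?A = "image Inl ` edges (cycle_graph k) :: (nat + nat \<times> nat) set set"
  let ?B = "(\<lambda>(v, i). {Inl v, Inr (v, i)}) ` ({..<k} \<times> {..<r}) :: (nat + nat \<times> nat) set set"
  have "card ?A \<le> k"
    using card_image_le[OF finite_cycle_edges] card_cycle_edges_le le_trans by blast
  moreover have "card ?B \<le> k * r"
    using card_image_le[of "{..<k} \<times> {..<r}" "\<lambda>(v, i). {Inl v, Inr (v, i)}"] by simp
  ultimately show ?thesis
    using card_Un_le[of ?A ?B] unfolding edges_jellyfish by linarith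
qed

lemma card_inner_edges_jellyfish_le:
  "card {e \<in> edges (jellyfish k r). \<forall>v\<in>e. \<exists>e'\<in>edges (jellyfish k r). v \<in> e' \<and> e' \<noteq> e} \<le> k"
proof -
  have "{e \<in> edges (jellyfish k r). \<forall>v\<in>e. \<exists>e'\<in>edges (jellyfish k r). v \<in> e' \<and> e' \<noteq> e}
    \<subseteq> image Inl ` edges (cycle_graph k)"
  proof
    fix e
    assume e: "e \<in> {e \<in> edges (jellyfish k r). \<forall>v\<in>e. \<exists>e'\<in>edges (jellyfish k r). v \<in> e' \<and> e' \<noteq> e}"
    have leaf: "e' = {Inl v, Inr (v, i)}" if "e' \<in> edges (jellyfish k r)" "Inr (v, i) \<in> e'" for e' v i
      using that unfolding edges_jellyfish by auto
    have "e \<noteq> {Inl v, Inr (v, i)}" for v i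
      using e leaf[of _ v i] by blast
    then show "e \<in> image Inl ` edges (cycle_graph k)"
      using e unfolding edges_jellyfish by auto
  qed
  then have "card {e \<in> edges (jellyfish k r). \<forall>v\<in>e. \<exists>e'\<in>edges (jellyfish k r). v \<in> e' \<and> e' \<noteq> e}
    \<le> card (image Inl ` edges (cycle_graph k) :: (nat + nat \<times> nat) set set)"
    by (intro card_mono finite_imageI finite_cycle_edges)
  also have "\<dots> \<le> card (edges (cycle_graph k))" by (rule card_image_le[OF finite_cycle_edges])
  also have "\<dots> \<le> k" by (rule card_cycle_edges_le)
  finally show ?thesis .
qed

lemma no_isolated_jellyfish_union_paths:
  assumes "v \<in> verts (disjoint_union (jellyfish k r) (copies t (path_graph 3)))"
  shows "\<exists>e\<in>edges (disjoint_union (jellyfish k r) (copies t (path_graph 3))). v \<in> e"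
proof (cases v)
  case (Inl u)
  have "\<exists>e\<in>edges (jellyfish k r). u \<in> e"
  proof (cases u)
    case (Inl i)
    have "i < k" using assms \<open>v = Inl u\<close> Inl
      by (auto simp: disjoint_union_def jellyfish_def attach_pendants_def cycle_graph_def)
    then have "{i, Suc i mod k} \<in> edges (cycle_graph k)" by (auto simp: cycle_graph_def)
    then have "Inl ` {i, Suc i mod k} \<in> edges (jellyfish k r)"
      unfolding edges_jellyfish by (intro UnI1 imageI)
    then show ?thesis using Inl by (intro bexI) auto
  next
    case (Inr x)
    then obtain i j where "x = (i, j)" "i < k" "j < r"
      using assms \<open>v = Inl u\<close>
      by (auto simp: disjoint_union_def jellyfish_def attach_pendants_def cycle_graph_def)
    then have "{Inl i, u} \<in> edges (jellyfish k r)"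
      unfolding edges_jellyfish Inr by (intro UnI2 image_eqI[of _ _ x]) auto
    then show ?thesis by blast
  qed
  then obtain e where e: "e \<in> edges (jellyfish k r)" "u \<in> e" by blast
  then have "Inl ` e \<in> edges (disjoint_union (jellyfish k r) (copies t (path_graph 3)))"
    by (simp add: disjoint_union_def)
  then show ?thesis using e Inl by (intro bexI) auto
next
  case (Inr x)
  then obtain i j where x: "x = (i, j)" "i < t" "j < 3"
    using assms by (auto simp: disjoint_union_def copies_def path_graph_def)
  have "j \<in> {0, 1} \<or> j \<in> {1, 2}" using x by auto
  then show ?thesis unfolding edges_union_paths using Inr x by auto
qed

text \<open>
  With \<open>x = n + 1/2\<close> for the number \<open>n = m + 2t\<close> of edges, the hypothesis says
  \<open>(x + t)\<^sup>2 \<le> 2x\<^sup>2 - 1/4\<close>, hence \<open>t \<le> (\<surd>2 - 1)x\<close>. As \<open>x\<close> contains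
  \<open>2t\<close>, this reads \<open>(3 - 2\<surd>2)t \<le> (\<surd>2 - 1)(m + 1/2)\<close>, and the factor \<open>3 + 2\<surd>2\<close> is the
  inverse of \<open>3 - 2\<surd>2\<close>.
\<close>
lemma sqrt2_bound:
  fixes m t :: nat
  assumes "(m + 3 * t) * (m + 3 * t + 1) \<le> 2 * ((m + 2 * t) * (m + 2 * t + 1))"
  shows "real t \<le> (1 + sqrt 2) * (real m + 1 / 2)"
proof -
  define x where "x = real m + 2 * real t + 1 / 2"
  have "real ((m + 3 * t) * (m + 3 * t + 1)) \<le> real (2 * ((m + 2 * t) * (m + 2 * t + 1)))"
    using assms by (simp only: of_nat_le_iff)
  then have "(x + real t)\<^sup>2 \<le> 2 * x\<^sup>2"
    by (simp add: x_def power2_eq_square algebra_simps)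
  then have "(x + real t)\<^sup>2 \<le> (sqrt 2 * x)\<^sup>2" by (simp add: power_mult_distrib)
  then have "x + real t \<le> sqrt 2 * x" by (rule power2_le_imp_le) (simp add: x_def)
  then have "(3 - 2 * sqrt 2) * real t \<le> (sqrt 2 - 1) * (real m + 1 / 2)"
    by (simp add: x_def algebra_simps)
  then have "(3 + 2 * sqrt 2) * ((3 - 2 * sqrt 2) * real t)
      \<le> (3 + 2 * sqrt 2) * ((sqrt 2 - 1) * (real m + 1 / 2))"
    by (rule mult_left_mono) simp
  moreover have "(3 + 2 * sqrt 2) * ((3 - 2 * sqrt 2) * real t) = real t"
    by (simp add: algebra_simps)
  moreover have "(3 + 2 * sqrt 2) * ((sqrt 2 - 1) * (real m + 1 / 2))
      = (1 + sqrt 2) * (real m + 1 / 2)"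
    by (simp add: algebra_simps)
  ultimately show ?thesis by linarith
qed

lemma jellyfish_union_paths_sqrt2_bound:
  assumes "k \<ge> 3" and anti: "antimagic (disjoint_union (jellyfish k r) (copies t (path_graph 3)))"
  shows "real t \<le> (1 + sqrt 2) * (real k * real r + real k + 1 / 2)"
proof -
  let ?H = "disjoint_union (jellyfish k r) (copies t (path_graph 3))"
  let ?m = "k * r + k"
  have J: "simple_graph (jellyfish k r)" by (rule simple_graph_jellyfish[OF assms(1)])
  have H: "simple_graph ?H"
    by (intro simple_graph_disjoint_union J simple_graph_copies simple_graph_path)
  have V: "card (verts ?H) = ?m + 3 * t"
  proof -
    have "card (verts ?H) = card (verts (jellyfish k r)) + card ({..<t} \<times> {..<3::nat})"
      using J by (simp add: disjoint_union_def copies_def path_graph_def simple_graph_def card_Plus)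
    then show ?thesis by (simp add: card_verts_jellyfish)
  qed
  have E: "card (edges ?H) \<le> ?m + 2 * t"
    using card_edges_union_paths_le[OF J, of t] card_edges_jellyfish_le[of k r] by linarith
  have "(?m + 3 * t) * (?m + 3 * t + 1) \<le> 2 * (card (edges ?H) * (card (edges ?H) + 1))"
    using antimagic_card_verts_bound[OF H anti] no_isolated_jellyfish_union_paths
    unfolding V by blast
  also have "\<dots> \<le> 2 * ((?m + 2 * t) * (?m + 2 * t + 1))"
    using E by (intro mult_le_mono) auto
  finally show ?thesis using sqrt2_bound[of ?m t] by simp
qed

lemma jellyfish_union_paths_linear_bound:
  assumes "k \<ge> 3" and "antimagic (disjoint_union (jellyfish k r) (copies t (path_graph 3)))"
  shows "t \<le> 2 * k * r + 7 * k + 1"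
proof -
  have "t \<le> 2 * (k * r + k) + 5 * k + 1"
    by (rule order_trans[OF antimagic_union_paths_bound[OF simple_graph_jellyfish[OF assms(1)] assms(2)]])
      (intro add_mono mult_le_mono2 order_refl card_edges_jellyfish_le card_inner_edges_jellyfish_le)
  then show ?thesis by (simp add: algebra_simps)
qed

theorem corollary8:
  "(\<forall>(r::nat) (k::nat) (t::nat). r \<ge> 1 \<longrightarrow> k \<ge> 3 \<longrightarrow>
      antimagic (disjoint_union (jellyfish k r) (copies t (path_graph 3))) \<longrightarrow>
      real t \<le> min ((1 + sqrt 2) * (real k * real r + real k + 1 / 2))
                   (2 * real k * real r + 7 * real k + 1)) \<and>
   (\<forall>r::nat. r \<ge> 11 \<longrightarrow> tau (jellyfish 3 r) \<le> ereal (6 * real r + 22))"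
proof (intro conjI allI impI)
  fix r k t :: nat
  assume k: "k \<ge> 3"
    and anti: "antimagic (disjoint_union (jellyfish k r) (copies t (path_graph 3)))"
  have "real t \<le> real (2 * k * r + 7 * k + 1)"
    using jellyfish_union_paths_linear_bound[OF k anti] by (simp only: of_nat_le_iff)
  then show "real t \<le> min ((1 + sqrt 2) * (real k * real r + real k + 1 / 2))
                   (2 * real k * real r + 7 * real k + 1)"
    using jellyfish_union_paths_sqrt2_bound[OF k anti] by simp
next
  fix r :: nat
  have "ereal (real t) \<le> ereal (6 * real r + 22)"
    if "\<forall>t'\<le>t. antimagic (disjoint_union (jellyfish 3 r) (copies t' (path_graph 3)))" for t
  proof -
    have "t \<le> 6 * r + 22" using jellyfish_union_paths_linear_bound[of 3 r t] that by simp
    then show ?thesis by simp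
  qed
  then show "tau (jellyfish 3 r) \<le> ereal (6 * real r + 22)"
    unfolding tau_def by (auto intro!: SUP_least)
qed

end
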